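(* Let $R$ be a commutative ring with identity and let $N$ be a proper submodule of an $R$-module $M$. The following statements are equivalent: (1) $N$ is a weakly $J$-submodule of $M$. (2) For every $m\in M\setminus N$, $(N:Rm)\subseteq (J(R)M:M)\cup (0:Rm)$. (3) Whenever $I$ is an ideal of $R$ and $m\in M$ with $0\neq Im\subseteq N$, then $I\subseteq (J(R)M:M)$ or $m\in N$. (4) Whenever $I$ is an ideal of $R$ and $K$ is a submodule of $M$ with $0\neq IK\subseteq N$, then $I\subseteq (J(R)M:M)$ or $K\subseteq N$.
   Context: Rings are commutative with identity and modules are unital. $J(R)$ is the Jacobson radical of $R$. For submodules $N,K$ of an $R$-module $M$, $(N:K)=\{r\in R: rK\subseteq N\}$. A proper submodule $N$ of $M$ is a weakly $J$-submodule if whenever $r\in R$, $m\in M$ satisfy $0\neq rm\in N$ and $r\notin (J(R)M:M)$, then $m\in N$. *)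

theory Defs
  imports "HOL-Algebra.Module" "HOL-Algebra.Ideal"
begin

text \<open>The intersection with \<open>carrier R\<close> only matters for the zero ring, which has no
  maximal ideal.\<close>

definition jacobson_radical :: "('a, 'c) ring_scheme \<Rightarrow> 'a set" where
  "jacobson_radical R = carrier R \<inter> \<Inter> {I. maximalideal I R}"

text \<open>The product \<open>I K\<close>: all finite nonempty sums of products \<open>a k\<close>. For an ideal \<open>I\<close> and a
  submodule \<open>K\<close> no rule for zero or for scalar multiples is needed; see \<open>ideal_smult_least\<close>.\<close>

inductive_set ideal_smult :: "('a, 'b, 'd) module_scheme \<Rightarrow> 'a set \<Rightarrow> 'b set \<Rightarrow> 'b set"
  for M (structure) and I and K where
    smult: "\<lbrakk>a \<in> I; k \<in> K\<rbrakk> \<Longrightarrow> a \<odot> k \<in> ideal_smult M I K"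
  | add: "\<lbrakk>x \<in> ideal_smult M I K; y \<in> ideal_smult M I K\<rbrakk> \<Longrightarrow> x \<oplus> y \<in> ideal_smult M I K"

text \<open>\<open>I m = {a m | a \<in> I}\<close> for an element \<open>m\<close>; in particular \<open>R m\<close> is
  \<open>elem_smult M (carrier R) m\<close>.\<close>

definition elem_smult :: "('a, 'b, 'd) module_scheme \<Rightarrow> 'a set \<Rightarrow> 'b \<Rightarrow> 'b set" where
  "elem_smult M I m = (\<lambda>a. a \<odot>\<^bsub>M\<^esub> m) ` I"

definition residual ::
  "('a, 'c) ring_scheme \<Rightarrow> ('a, 'b, 'd) module_scheme \<Rightarrow> 'b set \<Rightarrow> 'b set \<Rightarrow> 'a set" where
  "residual R M N K = {r \<in> carrier R. (\<lambda>k. r \<odot>\<^bsub>M\<^esub> k) ` K \<subseteq> N}"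

text \<open>\<open>(J(R)M : M)\<close>\<close>

definition jacobson_residual ::
  "('a, 'c) ring_scheme \<Rightarrow> ('a, 'b, 'd) module_scheme \<Rightarrow> 'a set" where
  "jacobson_residual R M =
     residual R M (ideal_smult M (jacobson_radical R) (carrier M)) (carrier M)"

definition proper_submodule ::
  "'b set \<Rightarrow> ('a, 'c) ring_scheme \<Rightarrow> ('a, 'b, 'd) module_scheme \<Rightarrow> bool" where
  "proper_submodule N R M \<longleftrightarrow> submodule N R M \<and> N \<noteq> carrier M"

definition weakly_J_submodule ::
  "'b set \<Rightarrow> ('a, 'c) ring_scheme \<Rightarrow> ('a, 'b, 'd) module_scheme \<Rightarrow> bool" where
  "weakly_J_submodule N R M \<longleftrightarrow>
     proper_submodule N R M \<and>
     (\<forall>r \<in> carrier R. \<forall>m \<in> carrier M.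
        r \<odot>\<^bsub>M\<^esub> m \<noteq> \<zero>\<^bsub>M\<^esub> \<and> r \<odot>\<^bsub>M\<^esub> m \<in> N \<and> r \<notin> jacobson_residual R M \<longrightarrow> m \<in> N)"

lemma (in module) ideal_smult_least:
  assumes I: "ideal I R" and K: "submodule K R M"
  shows "submodule (ideal_smult M I K) R M"
    and "\<lbrakk>submodule H R M; \<And>a k. \<lbrakk>a \<in> I; k \<in> K\<rbrakk> \<Longrightarrow> a \<odot>\<^bsub>M\<^esub> k \<in> H\<rbrakk> \<Longrightarrow> ideal_smult M I K \<subseteq> H"
proof -
  interpret I: ideal I R by (rule I)
  note K' = submoduleE[OF K]
  have KM: "k \<in> carrier M" if "k \<in> K" for k using K'(1) that by blast
  have carr: "x \<in> carrier M" if "x \<in> ideal_smult M I K" for x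
    using that by induction (auto intro: KM I.Icarr)
  have sc: "r \<odot>\<^bsub>M\<^esub> x \<in> ideal_smult M I K" if "x \<in> ideal_smult M I K" "r \<in> carrier R" for r x
    using that
  proof induction
    case (smult a k)
    then have "r \<odot>\<^bsub>M\<^esub> (a \<odot>\<^bsub>M\<^esub> k) = (r \<otimes> a) \<odot>\<^bsub>M\<^esub> k"
      by (simp add: smult_assoc1 I.Icarr KM)
    then show ?case using smult by (simp add: ideal_smult.smult I.I_l_closed)
  next
    case (add x y)
    then show ?case by (simp add: smult_r_distr carr ideal_smult.add)
  qed
  obtain k where k: "k \<in> K" using K'(2) by blast
  have zero: "\<zero>\<^bsub>M\<^esub> \<in> ideal_smult M I K"
    using ideal_smult.smult[OF I.zero_closed k, of M] KM[OF k] by simp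
  show "submodule (ideal_smult M I K) R M"
  proof (rule submoduleI)
    fix x assume x: "x \<in> ideal_smult M I K"
    have "\<ominus>\<^bsub>M\<^esub> x = (\<ominus> \<one>) \<odot>\<^bsub>M\<^esub> x" using carr[OF x] by (simp add: smult_l_minus)
    then show "\<ominus>\<^bsub>M\<^esub> x \<in> ideal_smult M I K" using sc[OF x] by simp
  qed (auto intro: carr zero sc ideal_smult.add)
  show "ideal_smult M I K \<subseteq> H"
    if H: "submodule H R M" and sm: "\<And>a k. \<lbrakk>a \<in> I; k \<in> K\<rbrakk> \<Longrightarrow> a \<odot>\<^bsub>M\<^esub> k \<in> H"
  proof
    fix x assume "x \<in> ideal_smult M I K"
    then show "x \<in> H" by induction (auto intro: sm submoduleE(5)[OF H])
  qed
qed

end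

theory Submission
  imports Defs
begin

text \<open>
  Two ideas carry the proof. First, \<open>r m' \<in> N\<close> for all \<open>m' \<in> R m\<close> as soon as \<open>r m \<in> N\<close>
  (\<open>residual_cyclic\<close>), so (2) is just the contrapositive form of (1): if \<open>m \<notin> N\<close> and
  \<open>r m \<in> N\<close>, then \<open>r \<in> (J(R)M : M)\<close> or \<open>r m = 0\<close>.

  Second, a group is never the union of two proper subgroups (\<open>subgroup_subset_Un\<close>), and this
  is what turns elementwise alternatives into alternatives for ideals and submodules. It is used
  twice. In (1) \<open>\<Longrightarrow>\<close> (3), (1) says that each \<open>m \<notin> N\<close> with \<open>I m \<subseteq> N\<close> satisfies
  \<open>I \<subseteq> (J(R)M : M) \<union> (0 : m)\<close>; both sets on the right are ideals, so \<open>I\<close> lies in one of them.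
  In (3) \<open>\<Longrightarrow>\<close> (4), if \<open>I \<not>\<subseteq> (J(R)M : M)\<close>, then (3) says that every element of \<open>K\<close> lies in \<open>N\<close> or is
  annihilated by \<open>I\<close>; both conditions define submodules, so \<open>K \<subseteq> N\<close> or \<open>I K = 0\<close>.

  Finally, (4) applied to the principal ideal of \<open>r\<close> and to \<open>K = R m\<close> gives back (1).
\<close>

lemma (in group) subgroup_subset_Un:
  assumes H: "subgroup H G" and A: "subgroup A G" and B: "subgroup B G"
    and cover: "H \<subseteq> A \<union> B"
  shows "H \<subseteq> A \<or> H \<subseteq> B"
proof (rule ccontr)
  assume "\<not> (H \<subseteq> A \<or> H \<subseteq> B)"
  then obtain a b where ab: "a \<in> H" "a \<notin> B" "b \<in> H" "b \<notin> A" by blast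
  then have in_AB: "a \<in> A" "b \<in> B" using cover by auto
  have carr: "a \<in> carrier G" "b \<in> carrier G"
    using ab subgroup.subset[OF H] by auto
  \<comment> \<open>Wherever \<open>a b\<close> lies, cancelling one factor puts the other factor into the wrong subgroup.\<close>
  have "a \<otimes> b \<in> A \<union> B" using cover subgroup.m_closed[OF H] ab by blast
  then show False
  proof
    assume "a \<otimes> b \<in> A"
    then have "inv a \<otimes> (a \<otimes> b) \<in> A"
      using in_AB A by (simp add: subgroup.m_closed subgroup.m_inv_closed)
    then show False using carr ab by (simp add: m_assoc[symmetric])
  next
    assume "a \<otimes> b \<in> B"
    then have "(a \<otimes> b) \<otimes> inv b \<in> B"
      using in_AB B by (simp add: subgroup.m_closed subgroup.m_inv_closed)
    then show False using carr ab by (simp add: m_assoc)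
  qed
qed

lemma (in ring) ideal_subset_Un:
  assumes "ideal I R" "ideal A R" "ideal B R" "I \<subseteq> A \<union> B"
  shows "I \<subseteq> A \<or> I \<subseteq> B"
  using assms add.subgroup_subset_Un
  by (simp add: ideal_def additive_subgroup_def)

lemma (in module) submodule_subset_Un:
  assumes "submodule K R M" "submodule A R M" "submodule B R M" "K \<subseteq> A \<union> B"
  shows "K \<subseteq> A \<or> K \<subseteq> B"
  using assms M.add.subgroup_subset_Un by (simp add: submodule_def)

lemma (in ring) jacobson_radical_ideal: "ideal (jacobson_radical R) R"
proof -
  \<comment> \<open>Inserting \<open>carrier R\<close> keeps the family nonempty for the zero ring.\<close>
  have "ideal (\<Inter> (insert (carrier R) {I. maximalideal I R})) R"
    by (rule i_Intersect) (auto intro: oneideal maximalideal.axioms)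
  then show ?thesis by (simp add: jacobson_radical_def)
qed

lemma (in module) residual_ideal:
  assumes H: "submodule H R M" and K: "K \<subseteq> carrier M"
  shows "ideal (residual R M H K) R"
proof (rule idealI)
  note H' = submoduleE[OF H]
  have zero: "\<zero>\<^bsub>M\<^esub> \<in> H"
    using subgroup.one_closed[OF submodule.axioms(1)[OF H]] by simp
  have mult: "a \<otimes> b \<in> residual R M H K"
    if "b \<in> residual R M H K" "a \<in> carrier R" for a b
    using that K by (fastforce simp: residual_def smult_assoc1 intro: H'(4))
  show "a \<otimes> b \<in> residual R M H K" "b \<otimes> a \<in> residual R M H K"
    if "b \<in> residual R M H K" "a \<in> carrier R" for a b
  proof -
    show "a \<otimes> b \<in> residual R M H K" using that by (rule mult)
    moreover have "b \<in> carrier R" using that by (simp add: residual_def)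
    ultimately show "b \<otimes> a \<in> residual R M H K" using that by (simp add: R.m_comm)
  qed
  show "subgroup (residual R M H K) (add_monoid R)"
  proof (rule R.add.subgroupI)
    show "residual R M H K \<subseteq> carrier R" by (auto simp: residual_def)
    have "\<zero> \<in> residual R M H K" using K zero by (auto simp: residual_def subset_iff)
    then show "residual R M H K \<noteq> {}" by blast
    show "a \<oplus> b \<in> residual R M H K"
      if "a \<in> residual R M H K" "b \<in> residual R M H K" for a b
      using that K by (fastforce simp: residual_def smult_l_distr intro: H'(5))
    show "\<ominus> a \<in> residual R M H K" if "a \<in> residual R M H K" for a
      using that K by (fastforce simp: residual_def smult_l_minus intro: H'(3))
  qed
qed (rule R.ring_axioms)

lemma (in module) jacobson_residual_ideal: "ideal (jacobson_residual R M) R"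
  unfolding jacobson_residual_def
  by (intro residual_ideal ideal_smult_least(1) R.jacobson_radical_ideal carrier_is_submodule
      subset_refl)

lemma (in module) zero_submodule: "submodule {\<zero>\<^bsub>M\<^esub>} R M"
  by (rule submoduleI) auto

lemma (in module) cyclic_submodule:
  assumes m: "m \<in> carrier M"
  shows "submodule (elem_smult M (carrier R) m) R M"
proof (rule submoduleI)
  show "elem_smult M (carrier R) m \<subseteq> carrier M"
    using m by (auto simp: elem_smult_def)
  show "\<zero>\<^bsub>M\<^esub> \<in> elem_smult M (carrier R) m"
    unfolding elem_smult_def using m by (intro image_eqI[of _ _ \<zero>]) auto
next
  fix x assume "x \<in> elem_smult M (carrier R) m"
  then obtain a where a: "a \<in> carrier R" "x = a \<odot>\<^bsub>M\<^esub> m" by (auto simp: elem_smult_def)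
  then show "\<ominus>\<^bsub>M\<^esub> x \<in> elem_smult M (carrier R) m"
    unfolding elem_smult_def using m
    by (intro image_eqI[of _ _ "\<ominus> a"]) (auto simp: smult_l_minus)
  show "r \<odot>\<^bsub>M\<^esub> x \<in> elem_smult M (carrier R) m" if "r \<in> carrier R" for r
    unfolding elem_smult_def using m a that
    by (intro image_eqI[of _ _ "r \<otimes> a"]) (auto simp: smult_assoc1)
  fix y assume "y \<in> elem_smult M (carrier R) m"
  then obtain b where b: "b \<in> carrier R" "y = b \<odot>\<^bsub>M\<^esub> m" by (auto simp: elem_smult_def)
  show "x \<oplus>\<^bsub>M\<^esub> y \<in> elem_smult M (carrier R) m"
    unfolding elem_smult_def using m a b
    by (intro image_eqI[of _ _ "a \<oplus> b"]) (auto simp: smult_l_distr)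
qed

lemma (in module) cyclic_self:
  assumes "m \<in> carrier M"
  shows "m \<in> elem_smult M (carrier R) m"
  unfolding elem_smult_def using assms by (intro image_eqI[of _ _ \<one>]) auto

text \<open>By commutativity \<open>r (a m) = a (r m)\<close>, so the generator alone decides whether \<open>r\<close> sends
  \<open>R m\<close> into a submodule.\<close>

lemma (in module) residual_cyclic:
  assumes N: "submodule N R M" and m: "m \<in> carrier M"
  shows "residual R M N (elem_smult M (carrier R) m) = residual R M N {m}"
proof
  show "residual R M N (elem_smult M (carrier R) m) \<subseteq> residual R M N {m}"
    using cyclic_self[OF m] by (auto simp: residual_def)
  show "residual R M N {m} \<subseteq> residual R M N (elem_smult M (carrier R) m)"
  proof
    fix r assume r: "r \<in> residual R M N {m}"
    have "r \<odot>\<^bsub>M\<^esub> (a \<odot>\<^bsub>M\<^esub> m) \<in> N" if a: "a \<in> carrier R" for a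
    proof -
      have "r \<odot>\<^bsub>M\<^esub> (a \<odot>\<^bsub>M\<^esub> m) = a \<odot>\<^bsub>M\<^esub> (r \<odot>\<^bsub>M\<^esub> m)"
        using r a m by (simp add: residual_def smult_assoc1[symmetric] R.m_comm)
      then show ?thesis using r a submoduleE(4)[OF N] by (simp add: residual_def)
    qed
    then show "r \<in> residual R M N (elem_smult M (carrier R) m)"
      using r by (auto simp: residual_def elem_smult_def)
  qed
qed

lemma (in module) annihilated_submodule:
  assumes I: "I \<subseteq> carrier R"
  shows "submodule {k \<in> carrier M. \<forall>a\<in>I. a \<odot>\<^bsub>M\<^esub> k = \<zero>\<^bsub>M\<^esub>} R M"
proof (rule submoduleI)
  fix r k assume r: "r \<in> carrier R" and k: "k \<in> {k \<in> carrier M. \<forall>a\<in>I. a \<odot>\<^bsub>M\<^esub> k = \<zero>\<^bsub>M\<^esub>}"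
  have "a \<odot>\<^bsub>M\<^esub> (r \<odot>\<^bsub>M\<^esub> k) = \<zero>\<^bsub>M\<^esub>" if a: "a \<in> I" for a
  proof -
    have "a \<odot>\<^bsub>M\<^esub> (r \<odot>\<^bsub>M\<^esub> k) = r \<odot>\<^bsub>M\<^esub> (a \<odot>\<^bsub>M\<^esub> k)"
      using subsetD[OF I a] r k by (simp add: smult_assoc1[symmetric] R.m_comm)
    then show ?thesis using a r k by simp
  qed
  then show "r \<odot>\<^bsub>M\<^esub> k \<in> {k \<in> carrier M. \<forall>a\<in>I. a \<odot>\<^bsub>M\<^esub> k = \<zero>\<^bsub>M\<^esub>}" using r k by simp
qed (use I in \<open>auto simp: subset_iff smult_r_distr smult_r_minus\<close>)

lemma (in module) weakly_J_iff_residual_cyclic: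
  assumes N: "proper_submodule N R M"
  shows "weakly_J_submodule N R M \<longleftrightarrow>
    (\<forall>m \<in> carrier M - N.
      residual R M N (elem_smult M (carrier R) m)
        \<subseteq> jacobson_residual R M \<union> residual R M {\<zero>\<^bsub>M\<^esub>} (elem_smult M (carrier R) m))"
proof -
  have "submodule N R M" using N by (simp add: proper_submodule_def)
  then show ?thesis
    using N zero_submodule
    by (simp add: weakly_J_submodule_def residual_cyclic) (auto simp: residual_def)
qed

text \<open>If \<open>m \<notin> N\<close>, the ideal \<open>I\<close> is contained in \<open>(N : m)\<close>, hence by the weak \<open>J\<close>-property
  covered by the two ideals \<open>(J(R)M : M)\<close> and \<open>(0 : m)\<close>; it is not contained in the latter because \<open>I m \<noteq> 0\<close>.\<close>

lemma (in module) weakly_J_ideal_elem: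
  assumes wJ: "weakly_J_submodule N R M" and I: "ideal I R" and m: "m \<in> carrier M"
    and nz: "elem_smult M I m \<noteq> {\<zero>\<^bsub>M\<^esub>}" and sub: "elem_smult M I m \<subseteq> N"
  shows "I \<subseteq> jacobson_residual R M \<or> m \<in> N"
proof (rule disjCI)
  assume "m \<notin> N"
  interpret I: ideal I R by (rule I)
  have "I \<subseteq> jacobson_residual R M \<union> residual R M {\<zero>\<^bsub>M\<^esub>} {m}"
    using wJ m sub \<open>m \<notin> N\<close>
    by (auto simp: weakly_J_submodule_def residual_def elem_smult_def image_subset_iff
        dest: I.Icarr)
  moreover have "ideal (residual R M {\<zero>\<^bsub>M\<^esub>} {m}) R"
    using m by (intro residual_ideal zero_submodule) simp
  moreover have "\<not> I \<subseteq> residual R M {\<zero>\<^bsub>M\<^esub>} {m}"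
  proof
    assume "I \<subseteq> residual R M {\<zero>\<^bsub>M\<^esub>} {m}"
    then have "elem_smult M I m = {\<zero>\<^bsub>M\<^esub>}"
      using I.zero_closed m
      by (auto simp: elem_smult_def residual_def intro!: image_eqI[of _ _ \<zero>])
    with nz show False by contradiction
  qed
  ultimately show "I \<subseteq> jacobson_residual R M"
    using R.ideal_subset_Un[OF I jacobson_residual_ideal] by blast
qed

text \<open>Unless \<open>I \<subseteq> (J(R)M : M)\<close>, the submodule \<open>K\<close> is covered by \<open>N\<close> and the
  submodule annihilated by \<open>I\<close>, and it is not contained in the latter because \<open>I K \<noteq> 0\<close>.\<close>

lemma (in module) ideal_submodule_of_ideal_elem:
  assumes elem: "\<And>m. \<lbrakk>m \<in> carrier M; elem_smult M I m \<noteq> {\<zero>\<^bsub>M\<^esub>}; elem_smult M I m \<subseteq> N\<rbrakk>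
      \<Longrightarrow> I \<subseteq> jacobson_residual R M \<or> m \<in> N"
    and N: "submodule N R M" and I: "ideal I R" and K: "submodule K R M"
    and nz: "ideal_smult M I K \<noteq> {\<zero>\<^bsub>M\<^esub>}" and sub: "ideal_smult M I K \<subseteq> N"
  shows "I \<subseteq> jacobson_residual R M \<or> K \<subseteq> N"
proof (unfold disj_imp, rule impI)
  assume not_J: "\<not> I \<subseteq> jacobson_residual R M"
  interpret I: ideal I R by (rule I)
  define A where "A = {k \<in> carrier M. \<forall>a\<in>I. a \<odot>\<^bsub>M\<^esub> k = \<zero>\<^bsub>M\<^esub>}"
  have A: "submodule A R M" unfolding A_def by (rule annihilated_submodule) (rule I.a_subset)
  have "K \<subseteq> N \<union> A"
  proof
    fix k assume k: "k \<in> K"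
    then have kM: "k \<in> carrier M" using submoduleE(1)[OF K] by blast
    have "elem_smult M I k \<subseteq> ideal_smult M I K"
      using k by (auto simp: elem_smult_def intro: ideal_smult.smult)
    then have "k \<in> N \<or> elem_smult M I k = {\<zero>\<^bsub>M\<^esub>}"
      using elem[OF kM] sub not_J by blast
    then show "k \<in> N \<union> A" using kM by (auto simp: A_def elem_smult_def)
  qed
  moreover have "\<not> K \<subseteq> A"
  proof
    assume KA: "K \<subseteq> A"
    have "ideal_smult M I K \<subseteq> {\<zero>\<^bsub>M\<^esub>}"
      using KA by (intro ideal_smult_least(2)[OF I K zero_submodule]) (auto simp: A_def)
    moreover have "ideal_smult M I K \<noteq> {}"
      using submoduleE(2)[OF ideal_smult_least(1)[OF I K]] .
    ultimately show False using nz by blast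
  qed
  ultimately show "K \<subseteq> N" using submodule_subset_Un[OF K N A] by blast
qed

text \<open>The hypothesis is used for the principal ideal \<open>I = R r\<close> and \<open>K = R m\<close>: their product is
  generated by multiples of \<open>r m\<close>, so it lies in \<open>N\<close> and is nonzero exactly when \<open>r m\<close> is so.\<close>

lemma (in module) weakly_J_of_ideal_submodule:
  assumes prod: "\<And>I K. \<lbrakk>ideal I R; submodule K R M; ideal_smult M I K \<noteq> {\<zero>\<^bsub>M\<^esub>};
      ideal_smult M I K \<subseteq> N\<rbrakk> \<Longrightarrow> I \<subseteq> jacobson_residual R M \<or> K \<subseteq> N"
    and N: "proper_submodule N R M"
  shows "weakly_J_submodule N R M"
  unfolding weakly_J_submodule_def
proof (intro conjI ballI impI N, elim conjE)
  fix r m assume r: "r \<in> carrier R" and m: "m \<in> carrier M" and nz: "r \<odot>\<^bsub>M\<^esub> m \<noteq> \<zero>\<^bsub>M\<^esub>"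
    and rm: "r \<odot>\<^bsub>M\<^esub> m \<in> N" and not_J: "r \<notin> jacobson_residual R M"
  let ?I = "PIdl r" and ?K = "elem_smult M (carrier R) m"
  have N': "submodule N R M" using N by (simp add: proper_submodule_def)
  have I: "ideal ?I R" using r by (rule R.cgenideal_ideal)
  have K: "submodule ?K R M" using m by (rule cyclic_submodule)
  have rI: "r \<in> ?I" using r by (rule R.cgenideal_self)
  have mK: "m \<in> ?K" using m by (rule cyclic_self)
  have "r \<in> residual R M N ?K"
    using r rm residual_cyclic[OF N' m] by (simp add: residual_def)
  then have "?I \<subseteq> residual R M N ?K"
    using submoduleE(1)[OF K] by (intro R.cgenideal_minimal residual_ideal N')
  then have "ideal_smult M ?I ?K \<subseteq> N"
    by (intro ideal_smult_least(2)[OF I K N']) (auto simp: residual_def)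
  moreover have "ideal_smult M ?I ?K \<noteq> {\<zero>\<^bsub>M\<^esub>}"
    using ideal_smult.smult[OF rI mK, of M] nz by auto
  ultimately have "?I \<subseteq> jacobson_residual R M \<or> ?K \<subseteq> N" by (intro prod I K)
  then show "m \<in> N" using rI mK not_J by blast
qed

theorem theorem1:
  fixes R :: "('a, 'c) ring_scheme" and M :: "('a, 'b, 'd) module_scheme" and N :: "'b set"
  assumes "module R M" and "proper_submodule N R M"
  shows
    "(weakly_J_submodule N R M \<longleftrightarrow>
       (\<forall>m \<in> carrier M - N.
          residual R M N (elem_smult M (carrier R) m)
            \<subseteq> jacobson_residual R M \<union> residual R M {\<zero>\<^bsub>M\<^esub>} (elem_smult M (carrier R) m)))
   \<and> (weakly_J_submodule N R M \<longleftrightarrow>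
       (\<forall>I m. ideal I R \<and> m \<in> carrier M \<and>
          elem_smult M I m \<noteq> {\<zero>\<^bsub>M\<^esub>} \<and> elem_smult M I m \<subseteq> N
            \<longrightarrow> I \<subseteq> jacobson_residual R M \<or> m \<in> N))
   \<and> (weakly_J_submodule N R M \<longleftrightarrow>
       (\<forall>I K. ideal I R \<and> submodule K R M \<and>
          ideal_smult M I K \<noteq> {\<zero>\<^bsub>M\<^esub>} \<and> ideal_smult M I K \<subseteq> N
            \<longrightarrow> I \<subseteq> jacobson_residual R M \<or> K \<subseteq> N))"
proof -
  interpret module R M by fact
  have N: "submodule N R M" using assms(2) by (simp add: proper_submodule_def)
  note ideal_elem = weakly_J_ideal_elem[of N]
    and ideal_submodule = ideal_submodule_of_ideal_elem[OF _ N]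
    and conversely = weakly_J_of_ideal_submodule[OF _ assms(2)]
  show ?thesis
  proof (intro conjI)
    show "weakly_J_submodule N R M \<longleftrightarrow>
       (\<forall>m \<in> carrier M - N.
          residual R M N (elem_smult M (carrier R) m)
            \<subseteq> jacobson_residual R M \<union> residual R M {\<zero>\<^bsub>M\<^esub>} (elem_smult M (carrier R) m))"
      by (rule weakly_J_iff_residual_cyclic) fact
    show "weakly_J_submodule N R M \<longleftrightarrow>
       (\<forall>I m. ideal I R \<and> m \<in> carrier M \<and>
          elem_smult M I m \<noteq> {\<zero>\<^bsub>M\<^esub>} \<and> elem_smult M I m \<subseteq> N
            \<longrightarrow> I \<subseteq> jacobson_residual R M \<or> m \<in> N)" (is "_ \<longleftrightarrow> ?three")
    proof
      show ?three if "weakly_J_submodule N R M"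
        using ideal_elem[OF that] by blast
      show "weakly_J_submodule N R M" if three: ?three
      proof (rule conversely)
        fix I K assume "ideal I R" "submodule K R M"
          "ideal_smult M I K \<noteq> {\<zero>\<^bsub>M\<^esub>}" "ideal_smult M I K \<subseteq> N"
        then show "I \<subseteq> jacobson_residual R M \<or> K \<subseteq> N"
          by (intro ideal_submodule) (use three in blast)
      qed
    qed
    show "weakly_J_submodule N R M \<longleftrightarrow>
       (\<forall>I K. ideal I R \<and> submodule K R M \<and>
          ideal_smult M I K \<noteq> {\<zero>\<^bsub>M\<^esub>} \<and> ideal_smult M I K \<subseteq> N
            \<longrightarrow> I \<subseteq> jacobson_residual R M \<or> K \<subseteq> N)" (is "_ \<longleftrightarrow> ?four")
    proof
      show ?four if wJ: "weakly_J_submodule N R M"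
      proof (intro allI impI, elim conjE)
        fix I K assume I: "ideal I R" and "submodule K R M"
          "ideal_smult M I K \<noteq> {\<zero>\<^bsub>M\<^esub>}" "ideal_smult M I K \<subseteq> N"
        then show "I \<subseteq> jacobson_residual R M \<or> K \<subseteq> N"
          by (intro ideal_submodule) (use ideal_elem[OF wJ I] in blast)
      qed
      show "weakly_J_submodule N R M" if ?four
        by (rule conversely) (use that in blast)
    qed
  qed
qed

end
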